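(* Let $\mu,\nu\in\mathbb{C}$, $\alpha>0$ and $\beta\in\mathbb{R}$, and suppose that $\alpha+\beta>0$ or $\nu\in\mathbb{N}_0$. Then $$(1+\tanh\beta\tanh\alpha)^{\nu}\,P_\nu^{-\mu}(\tanh(\alpha+\beta))=\sum_{n=0}^{\infty}\frac{(-1)^n(\mu-\nu)_n(\nu)_n\,\mathcal{F}_n(\beta)}{n!\,e^{\alpha n}}\,P_\nu^{-\mu-n}(\tanh\alpha),$$ where $$\mathcal{F}_n(\beta)=\frac{e^{\beta(\nu-\mu)}}{\cosh^{\nu}\beta}\,F\left(-n,-\nu;1-\nu-n;e^{-2\beta}\right).$$
   Context: For $x\in(-1,1)$ and $\nu,\mu\in\mathbb{C}$ the Ferrers function of the first kind is $P_\nu^{-\mu}(x)=\left(\frac{1-x}{1+x}\right)^{\mu/2}\frac{F(-\nu,\nu+1;1+\mu;\frac{1-x}{2})}{\Gamma(1+\mu)}$, where $F$ is the Gauss hypergeometric function and $F(a,b;c;z)/\Gamma(c)$ is read as $\sum_k \frac{(a)_k(b)_k}{\Gamma(c+k)k!}z^k$, entire in $c$; it is entire in each of $\nu,\mu$. $(a)_n=\Gamma(a+n)/\Gamma(a)$, $\mathbb{N}_0=\{0,1,2,\dots\}$. The product $(\nu)_nF(-n,-\nu;1-\nu-n;z)$ is a polynomial in $\nu$ and $z$ and is read as such (limiting value) when $\nu$ is a non-positive integer; equivalently, $\frac{(-1)^n(\nu)_n}{n!}F(-n,-\nu;1-\nu-n;z)$ is the coefficient of $t^n$ in the Taylor expansion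 of $(1+zt)^{\nu}(1+t)^{-\nu}$ at $t=0$. *)

theory Defs
  imports "HOL-Analysis.Analysis"
begin

definition hyp2F1 :: "complex \<Rightarrow> complex \<Rightarrow> complex \<Rightarrow> complex \<Rightarrow> complex" where
  "hyp2F1 a b c z = eval_fps (fps_hypergeo [a, b] [c] 1) z"

text \<open>
  The regularized function $F(a,b;c;z)/\Gamma(c)$. It is entire in $c$ because the library's
  reciprocal Gamma function vanishes at the poles of $\Gamma$.
\<close>

definition hyp2F1_reg :: "complex \<Rightarrow> complex \<Rightarrow> complex \<Rightarrow> complex \<Rightarrow> complex" where
  "hyp2F1_reg a b c z =
     (\<Sum>k. pochhammer a k * pochhammer b k * rGamma (c + of_nat k) / fact k * z ^ k)"

text \<open>
  \<open>ferrers_P \<nu> \<kappa> x\<close> has degree \<open>\<nu>\<close> and upper index \<open>\<kappa>\<close>, so that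
  $P_\nu^{-\mu}(x)$ is \<open>ferrers_P \<nu> (- \<mu>) x\<close>; it is meaningful for $-1 < x < 1$.
  The base of the complex power is then a positive real, so the power is unambiguous.
\<close>

definition ferrers_P :: "complex \<Rightarrow> complex \<Rightarrow> real \<Rightarrow> complex" where
  "ferrers_P \<nu> \<kappa> x =
     of_real ((1 - x) / (1 + x)) powr (- \<kappa> / 2) *
     hyp2F1_reg (- \<nu>) (\<nu> + 1) (1 - \<kappa>) (of_real ((1 - x) / 2))"

text \<open>
  The product $(\nu)_n F(-n,-\nu;1-\nu-n;z)$. For \<open>\<nu>\<close> a non-positive integer the lower
  parameter may be a non-positive integer at which the terminating sum breaks down, so the
  product is taken as its limit there.
\<close>

definition poch_hyp2F1 :: "complex \<Rightarrow> nat \<Rightarrow> complex \<Rightarrow> complex" where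
  "poch_hyp2F1 \<nu> n z =
     (let f = (\<lambda>w. pochhammer w n * hyp2F1 (- of_nat n) (- w) (1 - w - of_nat n) z)
      in if \<nu> \<in> \<int>\<^sub>\<le>\<^sub>0 then Lim (at \<nu>) f else f \<nu>)"

text \<open>
  The product $(\nu)_n \mathcal{F}_n(\beta)$, where
  $\mathcal{F}_n(\beta) = e^{\beta(\nu-\mu)} (\cosh\beta)^{-\nu} F(-n,-\nu;1-\nu-n;e^{-2\beta})$.
  The factor $(\nu)_n$ is included because $\mathcal{F}_n(\beta)$ alone may be undefined
  for \<open>\<nu>\<close> a non-positive integer.
\<close>

definition poch_cal_F :: "complex \<Rightarrow> complex \<Rightarrow> nat \<Rightarrow> real \<Rightarrow> complex" where
  "poch_cal_F \<mu> \<nu> n \<beta> =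
     exp (of_real \<beta> * (\<nu> - \<mu>)) / of_real (cosh \<beta>) powr \<nu> *
     poch_hyp2F1 \<nu> n (of_real (exp (- 2 * \<beta>)))"

text \<open>
  The limit above exists, and the product is the following polynomial in \<open>\<nu>\<close> and \<open>z\<close>
  for every \<open>\<nu>\<close>.
\<close>

lemma pochhammer_mult_hyp2F1:
  assumes "\<And>j. j < n \<Longrightarrow> \<nu> \<noteq> - of_nat j"
  shows "pochhammer \<nu> n * hyp2F1 (- of_nat n) (- \<nu>) (1 - \<nu> - of_nat n) z =
    (\<Sum>k\<le>n. of_nat (n choose k) * pochhammer \<nu> (n - k) * pochhammer (- \<nu>) k * z ^ k)"
proof -
  have "hyp2F1 (- of_nat n) (- \<nu>) (1 - \<nu> - of_nat n) z =
    (\<Sum>k. pochhammer (- of_nat n) k * pochhammer (- \<nu>) k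
      / (pochhammer (1 - \<nu> - of_nat n) k * fact k) * z ^ k)"
    by (simp add: hyp2F1_def eval_fps_def)
  also have "\<dots> = (\<Sum>k\<le>n. pochhammer (- of_nat n) k * pochhammer (- \<nu>) k
      / (pochhammer (1 - \<nu> - of_nat n) k * fact k) * z ^ k)"
    by (rule suminf_finite) (auto simp: pochhammer_of_nat_eq_0_lemma)
  finally have F: "hyp2F1 (- of_nat n) (- \<nu>) (1 - \<nu> - of_nat n) z = \<dots>" .
  show ?thesis
    unfolding F sum_distrib_left
  proof (rule sum.cong[OF refl])
    fix k assume "k \<in> {..n}"
    then have k: "k \<le> n" by simp
    have split: "pochhammer \<nu> n = pochhammer \<nu> (n - k) * pochhammer (\<nu> + of_nat (n - k)) k"
      using pochhammer_product[of "n - k" n \<nu>] k by simp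
    have "pochhammer \<nu> n \<noteq> 0"
      using assms by (auto simp: pochhammer_eq_0_iff)
    then have nz: "pochhammer (\<nu> + of_nat (n - k)) k \<noteq> 0"
      using split by auto
    have "1 - \<nu> - of_nat n = - (\<nu> + of_nat n - 1)"
      by simp
    then have c: "pochhammer (1 - \<nu> - of_nat n) k
        = (- 1) ^ k * pochhammer (\<nu> + of_nat (n - k)) k"
      using pochhammer_minus[of "\<nu> + of_nat n - 1" k] k
      by (simp add: of_nat_diff algebra_simps)
    have "(of_nat (n choose k) :: complex) = of_nat n gchoose k"
      by (simp add: binomial_gbinomial)
    then have b: "(of_nat (n choose k) :: complex) = (- 1) ^ k * pochhammer (- of_nat n) k / fact k"
      by (simp add: gbinomial_pochhammer)
    show "pochhammer \<nu> n * (pochhammer (- of_nat n) k * pochhammer (- \<nu>) k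
        / (pochhammer (1 - \<nu> - of_nat n) k * fact k) * z ^ k) =
      of_nat (n choose k) * pochhammer \<nu> (n - k) * pochhammer (- \<nu>) k * z ^ k"
      unfolding split c b using nz
      by (cases "even k") (simp_all add: field_simps)
  qed
qed

lemma poch_hyp2F1_eq:
  "poch_hyp2F1 \<nu> n z =
    (\<Sum>k\<le>n. of_nat (n choose k) * pochhammer \<nu> (n - k) * pochhammer (- \<nu>) k * z ^ k)"
proof (cases "\<nu> \<in> \<int>\<^sub>\<le>\<^sub>0")
  case False
  then have "\<nu> \<noteq> - of_nat j" for j
    by auto
  then show ?thesis
    using False pochhammer_mult_hyp2F1[of n \<nu> z] by (simp add: poch_hyp2F1_def)
next
  case True
  let ?f = "\<lambda>w. pochhammer w n * hyp2F1 (- of_nat n) (- w) (1 - w - of_nat n) z"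
  let ?p = "\<lambda>w. \<Sum>k\<le>n. of_nat (n choose k) * pochhammer w (n - k) * pochhammer (- w) k * z ^ k"
  have "\<not> \<nu> islimpt ((\<lambda>j. - of_nat j) ` {..<n})"
    by (intro islimpt_finite) auto
  then have "eventually (\<lambda>w. w \<notin> (\<lambda>j. - of_nat j) ` {..<n}) (at \<nu>)"
    by (simp add: islimpt_iff_eventually)
  then have ev: "eventually (\<lambda>w. ?p w = ?f w) (at \<nu>)"
  proof eventually_elim
    case (elim w)
    then have "w \<noteq> - of_nat j" if "j < n" for j
      using that by auto
    then show ?case
      using pochhammer_mult_hyp2F1[of n w z] by simp
  qed
  have "(?p \<longlongrightarrow> ?p \<nu>) (at \<nu>)"
    unfolding pochhammer_prod by (intro tendsto_intros)
  then have "(?f \<longlongrightarrow> ?p \<nu>) (at \<nu>)"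
    using ev by (rule Lim_transform_eventually)
  then have "Lim (at \<nu>) ?f = ?p \<nu>"
    by (intro tendsto_Lim) auto
  then show ?thesis
    using True by (simp add: poch_hyp2F1_def)
qed

end

theory Submission
  imports Defs
begin

text \<open>
  Put $q = e^{-2\alpha}$ and $z = e^{-2\beta}$. Pfaff's transformation expresses
  $P_\nu^{-\mu}(\tanh\alpha)$ through $F(-\nu,\mu-\nu;1+\mu;-q)$, and the theorem becomes
  $$\sum_n (\mu-\nu)_n\, c_n q^n \frac{F(-\nu,\mu-\nu+n;1+\mu+n;-q)}{\Gamma(1+\mu+n)}
    = \frac{F(-\nu,\mu-\nu;1+\mu;-zq)}{\Gamma(1+\mu)},$$
  where $c_n$ is the coefficient of $t^n$ in $(1+zt)^\nu(1+t)^{-\nu}$. Expanding the left-hand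
  side gives a double series whose terms depend on the two indices $n,k$ only through $n+k$, except
  for the factor $c_n\binom{\nu}{k}$. Summed over $n+k=N$, this factor gives the coefficient of
  $t^N$ in $(1+zt)^\nu(1+t)^{-\nu}(1+t)^\nu$. The hypotheses make the double series absolutely
  convergent.
\<close>

section \<open>Double series and growth estimates\<close>

text \<open>Summability of the norms grouped by antidiagonals makes the whole family over pairs
  absolutely summable, so Fubini allows regrouping it into rows.\<close>

lemma sums_suminf_diagonal:
  fixes f :: "nat \<Rightarrow> nat \<Rightarrow> 'a::banach"
  assumes "summable (\<lambda>N. \<Sum>k\<le>N. norm (f (N - k) k))"
  shows "summable (f n)"
    and "(\<lambda>n. \<Sum>k. f n k) sums (\<Sum>N. \<Sum>k\<le>N. f (N - k) k)"
proof -
  define D where "D = Sigma (UNIV :: nat set) (\<lambda>N. {..N})"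
  define h :: "nat \<times> nat \<Rightarrow> nat \<times> nat" where "h = (\<lambda>(N, k). (N - k, k))"
  \<comment> \<open>\<open>h\<close> sends position \<open>k\<close> of diagonal \<open>N\<close> to
    the pair \<open>(N - k, k)\<close>; the index sum \<open>n + k\<close> recovers
    \<open>N\<close>.\<close>
  have bij: "bij_betw h D UNIV"
    by (rule bij_betw_byWitness[where f' = "\<lambda>(n, k). (n + k, k)"]) (auto simp: D_def h_def)
  have "(\<lambda>p. norm (case_prod f (h p))) summable_on D"
    unfolding D_def
  proof (rule summable_on_SigmaI)
    show "((\<lambda>k. norm (case_prod f (h (N, k)))) has_sum (\<Sum>k\<le>N. norm (f (N - k) k))) {..N}" for N
      by (auto simp: h_def intro!: has_sum_finiteI)
    show "(\<lambda>N. \<Sum>k\<le>N. norm (f (N - k) k)) summable_on UNIV"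
      using assms by (subst summable_on_UNIV_nonneg_real_iff) (auto intro: sum_nonneg)
  qed auto
  then have abs: "(\<lambda>p. norm (case_prod f p)) summable_on UNIV \<times> UNIV"
    using summable_on_reindex_bij_betw[OF bij, of "\<lambda>p. norm (case_prod f p)"] by simp
  then have row: "f n summable_on UNIV" for n
    using iffD1[OF Infinite_Sum.abs_summable_on_Sigma_iff abs] by (auto intro: abs_summable_summable)
  have "case_prod f summable_on UNIV \<times> UNIV"
    using abs by (rule abs_summable_summable)
  then have "(\<lambda>p. case_prod f (h p)) summable_on D"
    using summable_on_reindex_bij_betw[OF bij, of "case_prod f"] by simp
  then obtain S where S: "((\<lambda>p. case_prod f (h p)) has_sum S) D"
    by (auto simp: summable_on_def)
  then have full: "(case_prod f has_sum S) (UNIV \<times> UNIV)"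
    using iffD1[OF has_sum_reindex_bij_betw[OF bij, of "case_prod f"] S] by simp
  show "summable (f n)" for n
    using row by (rule summable_on_imp_summable)
  have eq: "infsum (f n) UNIV = suminf (f n)" for n
    using has_sum_imp_sums[OF has_sum_infsum[OF row]] by (simp add: sums_iff)
  have "((\<lambda>n. infsum (f n) UNIV) has_sum S) UNIV"
    using full row by (intro has_sum_SigmaD[OF full]) auto
  then have 1: "(\<lambda>n. suminf (f n)) sums S"
    unfolding eq by (rule has_sum_imp_sums)
  have "((\<lambda>N. \<Sum>k\<le>N. f (N - k) k) has_sum S) UNIV"
    by (rule has_sum_SigmaD[OF S[unfolded D_def]]) (auto simp: h_def intro!: has_sum_finiteI)
  then have "S = (\<Sum>N. \<Sum>k\<le>N. f (N - k) k)"
    using has_sum_imp_sums sums_unique by blast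
  with 1 show "(\<lambda>n. suminf (f n)) sums (\<Sum>N. \<Sum>k\<le>N. f (N - k) k)"
    by simp
qed

text \<open>Consecutive terms have ratio \<open>(d + k) / (c + k)\<close>, which tends to 1, so
  every \<open>R > 1\<close> eventually dominates it.\<close>

lemma pochhammer_rGamma_bound:
  fixes d c :: complex
  assumes "R > 1"
  obtains C where "C > 0" "\<And>k. norm (pochhammer d k * rGamma (c + of_nat k)) \<le> C * R ^ k"
proof -
  define u where "u = (\<lambda>k. norm (pochhammer d k * rGamma (c + of_nat k)))"
  \<comment> \<open>From this index on
    \<open>norm (c + k) \<ge> k - norm c \<ge> norm (d - c) / (R - 1)\<close>, which is what gives
    \<open>norm (d + k) \<le> R * norm (c + k)\<close>.\<close>
  obtain N where N: "real N \<ge> norm c + norm (d - c) / (R - 1)"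
    using real_arch_simple by blast
  have step: "u (Suc k) \<le> R * u k" if "k \<ge> N" for k
  proof -
    have "norm (d - c) / (R - 1) \<le> real k - norm c"
      using N that by simp
    also have "\<dots> \<le> norm (c + of_nat k)"
      using norm_triangle_ineq2[of "of_nat k" "- c"] by (simp add: add.commute)
    finally have "norm (d - c) \<le> (R - 1) * norm (c + of_nat k)"
      using assms by (simp add: field_simps)
    moreover have "norm (d + of_nat k) \<le> norm (d - c) + norm (c + of_nat k)"
      using norm_triangle_ineq[of "d - c" "c + of_nat k"] by simp
    ultimately have le: "norm (d + of_nat k) \<le> R * norm (c + of_nat k)"
      by (simp add: algebra_simps)
    \<comment> \<open>The recurrence is used without division, so it also covers
      \<open>c + k = 0\<close>.\<close>
    have "rGamma (c + of_nat k) = (c + of_nat k) * rGamma (c + of_nat (Suc k))"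
      using rGamma_plus1[of "c + of_nat k"] by (simp add: algebra_simps)
    then have "R * u k = norm (pochhammer d k) * norm (rGamma (c + of_nat (Suc k)))
        * (R * norm (c + of_nat k))"
      by (simp add: u_def norm_mult)
    also have "\<dots> \<ge> norm (pochhammer d k) * norm (rGamma (c + of_nat (Suc k)))
        * norm (d + of_nat k)"
      by (intro mult_left_mono le) auto
    also have "norm (pochhammer d k) * norm (rGamma (c + of_nat (Suc k)))
        * norm (d + of_nat k) = u (Suc k)"
      by (simp add: u_def norm_mult pochhammer_Suc)
    finally show ?thesis .
  qed
  \<comment> \<open>The sum dominates the terms up to index \<open>N\<close>, where the ratio bound
    may fail; the summand 1 makes \<open>C\<close> positive.\<close>
  define C where "C = 1 + (\<Sum>k\<le>N. u k)"
  have u0: "u k \<ge> 0" for k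
    by (simp add: u_def)
  have "u k \<le> C * R ^ k" for k
  proof (induction k)
    case 0
    have "u 0 \<le> (\<Sum>k\<le>N. u k)"
      by (rule member_le_sum) (auto simp: u0)
    then show ?case by (simp add: C_def)
  next
    case (Suc k)
    show ?case
    proof (cases "k \<ge> N")
      case True
      have "u (Suc k) \<le> R * u k" using step True .
      also have "\<dots> \<le> R * (C * R ^ k)"
        using Suc assms by (intro mult_left_mono) auto
      finally show ?thesis by (simp add: mult_ac)
    next
      case False
      have "u (Suc k) \<le> (\<Sum>k\<le>N. u k)"
        using False by (intro member_le_sum) (auto simp: u0)
      also have "\<dots> \<le> C * 1" by (simp add: C_def)
      also have "\<dots> \<le> C * R ^ Suc k"
        using assms u0 by (intro mult_left_mono) (auto simp: C_def sum_nonneg simp del: power_Suc)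
      finally show ?thesis .
    qed
  qed
  moreover have "C > 0"
    using u0 by (simp add: C_def add_pos_nonneg sum_nonneg)
  ultimately show ?thesis
    using that by (simp add: u_def)
qed

section \<open>Pfaff's transformation\<close>

text \<open>This is the Chu-Vandermonde identity. Writing every reciprocal Gamma value as a multiple
  of \<open>rGamma (c + N)\<close> leaves the binomial theorem for rising factorials with parameters
  \<open>1 - c - N\<close> and \<open>c - b\<close>, whose sum is \<open>- (b + N - 1)\<close>. It
  evaluates the diagonals in Pfaff's transformation.\<close>

lemma sum_binomial_pochhammer_rGamma:
  fixes b c :: complex
  shows "(\<Sum>j\<le>N. of_nat (N choose j) *
      ((- 1) ^ (N - j) * pochhammer (c - b) (N - j) * rGamma (c + of_nat (N - j)))) =
    pochhammer b N * rGamma (c + of_nat N)"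
proof -
  have "(\<Sum>j\<le>N. of_nat (N choose j) *
      ((- 1) ^ (N - j) * pochhammer (c - b) (N - j) * rGamma (c + of_nat (N - j)))) =
    (\<Sum>j\<le>N. of_nat (N choose j) * pochhammer (1 - c - of_nat N) j * pochhammer (c - b) (N - j))
      * (- 1) ^ N * rGamma (c + of_nat N)"
    unfolding sum_distrib_right
  proof (rule sum.cong[OF refl])
    fix j assume "j \<in> {..N}"
    then have j: "j \<le> N" by simp
    have "rGamma (c + of_nat (N - j)) =
        pochhammer (c + of_nat (N - j)) j * rGamma (c + of_nat (N - j) + of_nat j)"
      by (rule pochhammer_rGamma)
    also have "c + of_nat (N - j) + of_nat j = c + of_nat N"
      using j by simp
    also have "pochhammer (c + of_nat (N - j)) j = (- 1) ^ j * pochhammer (1 - c - of_nat N) j"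
      using pochhammer_minus'[of "c + of_nat N - 1" j] j by (simp add: algebra_simps)
    finally have r: "rGamma (c + of_nat (N - j)) =
      (- 1) ^ j * pochhammer (1 - c - of_nat N) j * rGamma (c + of_nat N)" .
    have s: "(- 1) ^ (N - j) * (- 1) ^ j = ((- 1) ^ N :: complex)"
      using j by (simp flip: power_add)
    have "of_nat (N choose j) *
        ((- 1) ^ (N - j) * pochhammer (c - b) (N - j) * rGamma (c + of_nat (N - j))) =
      of_nat (N choose j) * pochhammer (1 - c - of_nat N) j * pochhammer (c - b) (N - j)
        * ((- 1) ^ (N - j) * (- 1) ^ j) * rGamma (c + of_nat N)"
      unfolding r by (simp add: mult_ac)
    then show "of_nat (N choose j) *
        ((- 1) ^ (N - j) * pochhammer (c - b) (N - j) * rGamma (c + of_nat (N - j))) =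
      of_nat (N choose j) * pochhammer (1 - c - of_nat N) j * pochhammer (c - b) (N - j)
        * (- 1) ^ N * rGamma (c + of_nat N)"
      unfolding s .
  qed
  also have "(\<Sum>j\<le>N. of_nat (N choose j) * pochhammer (1 - c - of_nat N) j
      * pochhammer (c - b) (N - j)) = pochhammer (- (b + of_nat N - 1)) N"
    by (subst pochhammer_binomial_sum[symmetric]) (simp add: algebra_simps)
  also have "\<dots> = (- 1) ^ N * pochhammer b N"
    by (subst pochhammer_minus) simp
  finally show ?thesis
    by (simp add: mult_ac flip: power_mult_distrib)
qed

lemma summable_norm_gbinomial_power:
  fixes a :: complex
  assumes "0 \<le> x" "x < 1 \<or> a \<in> \<nat>"
  shows "summable (\<lambda>n. norm (a gchoose n) * x ^ n)"
proof (cases "x < 1")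
  case True
  \<comment> \<open>Convergence at the larger radius \<open>r\<close> yields absolute convergence at
    \<open>x\<close>.\<close>
  then obtain r where r: "x < r" "r < 1"
    using dense by blast
  then have nr: "norm (complex_of_real r) = r"
    using assms by simp
  then have "summable (\<lambda>n. (a gchoose n) * complex_of_real r ^ n)"
    using gen_binomial_complex[of "of_real r" a] r by (auto simp: sums_iff)
  from powser_insidea[OF this, of "of_real x"] show ?thesis
    using assms r nr by (simp add: norm_mult norm_power)
next
  case False
  then obtain m where m: "a = of_nat m"
    using assms by (auto elim: Nats_cases)
  have "a gchoose n = 0" if "n > m" for n
    using that by (simp add: m flip: binomial_gbinomial)
  then show ?thesis
    by (intro summable_finite[of "{..m}"]) auto
qed

text \<open>The right-hand side is expanded by the binomial series for
  \<open>(1 - w) powr (- a - k)\<close> and regrouped by powers of \<open>w\<close>. The norms on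
  diagonal \<open>N\<close> sum to at most a constant times
  \<open>norm ((- a) gchoose N) * (norm w * (1 + R)) ^ N\<close>. With \<open>R\<close> close to 1
  this is summable for \<open>norm w < 1 / 2\<close>; for \<open>- a\<close> in
  \<open>\<nat>\<close> the terms vanish eventually.\<close>

lemma hyp2F1_reg_Pfaff:
  assumes "norm w < 1" "norm w < 1 / 2 \<or> - a \<in> \<nat>"
  shows "hyp2F1_reg a b c w = (1 - w) powr (- a) * hyp2F1_reg a (c - b) c (- (w / (1 - w)))"
proof -
  \<comment> \<open>The first value gives
    \<open>1 - norm w * (1 + R) = (1 - 2 * norm w) * (1 - norm w)\<close>, positive when
    \<open>norm w < 1 / 2\<close>. In the terminating case any \<open>R > 1\<close> serves.\<close>
  define R where "R = (if norm w < 1 / 2 then 2 - 2 * norm w else 2)"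
  have R: "R > 1" "norm w * (1 + R) < 1 \<or> - a \<in> \<nat>"
  proof -
    show "R > 1" by (simp add: R_def)
    have "0 < (1 - 2 * norm w) * (1 - norm w)" if "norm w < 1 / 2"
      using that by simp
    then show "norm w * (1 + R) < 1 \<or> - a \<in> \<nat>"
      using assms by (auto simp: R_def algebra_simps)
  qed
  have w1: "w \<noteq> 1" using assms by auto
  obtain C where C: "C > 0"
    "\<And>k. norm (pochhammer (c - b) k * rGamma (c + of_nat k)) \<le> C * R ^ k"
    using pochhammer_rGamma_bound[OF R(1), of "c - b" c] by blast
  define g where "g = (\<lambda>k. pochhammer (c - b) k * rGamma (c + of_nat k))"
  define p where "p = (\<lambda>k. pochhammer a k * g k / fact k * (- w) ^ k)"
  \<comment> \<open>\<open>f k j\<close> is the \<open>j\<close>-th binomial term of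
    \<open>p k * (1 - w) powr (- a - of_nat k)\<close>, the \<open>k\<close>-th term of the
    right-hand side.\<close>
  define f where "f = (\<lambda>k j. p k * (((- a - of_nat k) gchoose j) * (- w) ^ j))"
  \<comment> \<open>The two rising factorials in \<open>a\<close> merge into
    \<open>pochhammer a N\<close>, so only a Chu-Vandermonde summand still depends on
    \<open>j\<close>.\<close>
  have diag: "f (N - j) j =
      pochhammer a N / fact N * w ^ N * (of_nat (N choose j) * ((- 1) ^ (N - j) * g (N - j)))"
    if "j \<le> N" for N j
  proof -
    have "(- a - of_nat (N - j)) gchoose j =
        (- 1) ^ j * pochhammer (a + of_nat (N - j)) j / fact j"
      by (simp add: gbinomial_pochhammer add.commute)
    moreover have "pochhammer a N = pochhammer a (N - j) * pochhammer (a + of_nat (N - j)) j"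
      using pochhammer_product[of "N - j" N a] that by simp
    moreover have "(of_nat (N choose j) :: complex) = fact N / (fact j * fact (N - j))"
      using that by (rule binomial_fact)
    moreover have "(- 1) ^ j * (- w) ^ j = w ^ j"
      by (simp flip: power_mult_distrib)
    moreover have "(- w) ^ (N - j) = (- 1) ^ (N - j) * w ^ (N - j)"
      by (rule power_minus)
    moreover have "w ^ N = w ^ (N - j) * w ^ j"
      using that by (simp flip: power_add)
    ultimately show ?thesis
      by (simp add: f_def p_def mult_ac)
  qed
  have diag_sum: "(\<Sum>j\<le>N. f (N - j) j) =
      pochhammer a N * pochhammer b N * rGamma (c + of_nat N) / fact N * w ^ N" for N
  proof -
    have "(\<Sum>j\<le>N. f (N - j) j) = pochhammer a N / fact N * w ^ N *
        (\<Sum>j\<le>N. of_nat (N choose j) * ((- 1) ^ (N - j) * g (N - j)))"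
      unfolding sum_distrib_left by (intro sum.cong) (auto simp: diag)
    then show ?thesis
      using sum_binomial_pochhammer_rGamma[of N c b] by (simp add: g_def mult_ac)
  qed
  have bound: "(\<Sum>j\<le>N. norm (f (N - j) j)) \<le> C * (norm ((- a) gchoose N) * (norm w * (1 + R)) ^ N)" for N
  proof -
    have "(\<Sum>j\<le>N. norm (f (N - j) j)) \<le>
      (\<Sum>j\<le>N. norm ((- a) gchoose N) * norm w ^ N * (of_nat (N choose j) * (C * R ^ (N - j))))"
    proof (rule sum_mono)
      fix j assume "j \<in> {..N}"
      then have "norm (f (N - j) j) =
          norm ((- a) gchoose N) * norm w ^ N * (of_nat (N choose j) * norm (g (N - j)))"
        by (simp add: diag gbinomial_pochhammer norm_mult norm_power norm_divide)
      also have "\<dots> \<le> norm ((- a) gchoose N) * norm w ^ N * (of_nat (N choose j) * (C * R ^ (N - j)))"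
        using C(2) by (intro mult_left_mono) (auto simp: g_def)
      finally show "norm (f (N - j) j) \<le> \<dots>" .
    qed
    also have "\<dots> = C * (norm ((- a) gchoose N) * norm w ^ N) *
        (\<Sum>j\<le>N. of_nat (N choose j) * 1 ^ j * R ^ (N - j))"
      by (simp add: sum_distrib_left mult_ac)
    also have "(\<Sum>j\<le>N. of_nat (N choose j) * 1 ^ j * R ^ (N - j)) = (1 + R) ^ N"
      by (rule binomial_ring[symmetric])
    finally show ?thesis by (simp add: power_mult_distrib mult_ac)
  qed
  have "summable (\<lambda>N. C * (norm ((- a) gchoose N) * (norm w * (1 + R)) ^ N))"
    using R by (intro summable_mult summable_norm_gbinomial_power) auto
  then have "summable (\<lambda>N. \<Sum>j\<le>N. norm (f (N - j) j))"
    by (rule summable_comparison_test'[of _ 0]) (use bound in \<open>simp add: sum_nonneg\<close>)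
  then have "(\<lambda>k. \<Sum>j. f k j) sums (\<Sum>N. \<Sum>j\<le>N. f (N - j) j)"
    by (rule sums_suminf_diagonal)
  also have "(\<Sum>N. \<Sum>j\<le>N. f (N - j) j) = hyp2F1_reg a b c w"
    by (simp add: diag_sum hyp2F1_reg_def)
  also have "(\<lambda>k. \<Sum>j. f k j) = (\<lambda>k. (1 - w) powr (- a) *
      (pochhammer a k * pochhammer (c - b) k * rGamma (c + of_nat k) / fact k * (- (w / (1 - w))) ^ k))"
  proof
    fix k
    have "(\<lambda>j. f k j) sums (p k * (1 + - w) powr (- a - of_nat k))"
      unfolding f_def using assms by (intro sums_mult gen_binomial_complex) simp
    moreover have "(1 + - w) powr (- a - of_nat k) = (1 - w) powr (- a) / (1 - w) ^ k"
      using w1 by (simp add: powr_diff powr_nat')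
    moreover have "(- (w / (1 - w))) ^ k = (- w) ^ k / (1 - w) ^ k"
      by (simp flip: power_divide)
    ultimately show "(\<Sum>j. f k j) = (1 - w) powr (- a) *
      (pochhammer a k * pochhammer (c - b) k * rGamma (c + of_nat k) / fact k * (- (w / (1 - w))) ^ k)"
      by (simp add: sums_iff p_def g_def mult_ac)
  qed
  finally have S: "(\<lambda>k. (1 - w) powr (- a) *
      (pochhammer a k * pochhammer (c - b) k * rGamma (c + of_nat k) / fact k * (- (w / (1 - w))) ^ k))
    sums hyp2F1_reg a b c w" .
  \<comment> \<open>Dividing by this factor transfers summability to the bare series, so that the
    factor can be pulled out of \<open>suminf\<close>.\<close>
  have "(1 - w) powr (- a) \<noteq> 0"
    using w1 by simp
  then have "summable (\<lambda>k. pochhammer a k * pochhammer (c - b) k * rGamma (c + of_nat k)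
      / fact k * (- (w / (1 - w))) ^ k)"
    using sums_summable[OF S] unfolding summable_cmult_iff by blast
  from suminf_mult[OF this, of "(1 - w) powr (- a)"] show ?thesis
    using S by (simp add: sums_iff hyp2F1_reg_def)
qed

section \<open>Taylor coefficients and the rescaled series\<close>

text \<open>The coefficient $c_n$ of the introduction.\<close>

definition binom_quot_coeff :: "complex \<Rightarrow> complex \<Rightarrow> nat \<Rightarrow> complex" where
  "binom_quot_coeff \<nu> z n = (\<Sum>k\<le>n. (\<nu> gchoose k) * z ^ k * ((- \<nu>) gchoose (n - k)))"

lemma poch_hyp2F1_conv_binom_quot_coeff:
  "(- 1) ^ n * poch_hyp2F1 \<nu> n z / fact n = binom_quot_coeff \<nu> z n"
  unfolding poch_hyp2F1_eq binom_quot_coeff_def sum_distrib_left sum_divide_distrib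
proof (rule sum.cong[OF refl])
  fix k assume "k \<in> {..n}"
  then have k: "k \<le> n" by simp
  have "(- 1) ^ n = ((- 1) ^ k * (- 1) ^ (n - k) :: complex)"
    using k by (simp flip: power_add)
  then show "(- 1) ^ n * (of_nat (n choose k) * pochhammer \<nu> (n - k) * pochhammer (- \<nu>) k * z ^ k)
      / fact n = (\<nu> gchoose k) * z ^ k * ((- \<nu>) gchoose (n - k))"
    by (simp add: binomial_fact[OF k] gbinomial_pochhammer mult_ac)
qed

text \<open>As formal power series, multiplying \<open>(1 + z t)^\<nu> (1 + t)^(-\<nu>)\<close> by
  \<open>(1 + t)^\<nu>\<close> cancels the second factor.\<close>

lemma binom_quot_coeff_convolution:
  "(\<Sum>k\<le>n. binom_quot_coeff \<nu> z (n - k) * (\<nu> gchoose k)) = (\<nu> gchoose n) * z ^ n"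
proof -
  define B where "B = Abs_fps (\<lambda>k. (\<nu> gchoose k) * z ^ k)"
  have "B * fps_binomial (- \<nu>) * fps_binomial \<nu> = B"
    by (simp add: mult.assoc flip: fps_binomial_add_mult)
  then have "fps_nth (fps_binomial \<nu> * (B * fps_binomial (- \<nu>))) n = fps_nth B n"
    by (metis mult.commute)
  moreover have "fps_nth (B * fps_binomial (- \<nu>)) m = binom_quot_coeff \<nu> z m" for m
    by (simp add: fps_mult_nth B_def binom_quot_coeff_def atLeast0AtMost)
  ultimately show ?thesis
    by (simp add: fps_mult_nth[of "fps_binomial \<nu>"] B_def atLeast0AtMost mult_ac)
qed

text \<open>Since \<open>(d)_n (d + n)_k = (d)_(n + k)\<close>, the convolution identity sums each
  diagonal. The double series is dominated by the Cauchy product of the series of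
  \<open>norm (c n) * x ^ n\<close> and \<open>norm (\<nu> gchoose k) * x ^ k\<close>, with
  \<open>x\<close> slightly above \<open>norm q\<close>.\<close>

lemma hyp2F1_reg_rescale_sums:
  assumes "norm q < 1" "norm (z * q) < 1 \<or> \<nu> \<in> \<nat>"
  shows "(\<lambda>n. pochhammer d n * binom_quot_coeff \<nu> z n * q ^ n *
      hyp2F1_reg (- \<nu>) (d + of_nat n) (e + of_nat n) (- q))
    sums hyp2F1_reg (- \<nu>) d e (- (z * q))"
proof -
  \<comment> \<open>\<open>s\<close> is the largest radius that must stay below 1 after enlargement;
    \<open>norm (z * q)\<close> counts only if it is below 1, as otherwise \<open>\<nu>\<close> is
    natural. Then \<open>R = 2 / (1 + s)\<close> satisfies both \<open>R > 1\<close> and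
    \<open>s * R < 1\<close>.\<close>
  define s where "s = (if norm (z * q) < 1 then max (norm q) (norm (z * q)) else norm q)"
  define R where "R = 2 / (1 + s)"
  have s: "0 \<le> s" "s < 1"
    using assms by (auto simp: s_def le_max_iff_disj)
  have R: "R > 1" and sR: "s * R < 1"
    using s by (auto simp: R_def field_simps)
  \<comment> \<open>The enlarged radius absorbs the growth \<open>R ^ N\<close> of the
    Pochhammer-Gamma factor.\<close>
  define x where "x = norm q * R"
  have x: "0 \<le> x" "x < 1" and zx: "norm z * x < 1 \<or> \<nu> \<in> \<nat>"
  proof -
    show "0 \<le> x" using R by (simp add: x_def)
    have "x \<le> s * R" unfolding x_def using R by (intro mult_right_mono) (auto simp: s_def)
    then show "x < 1" using sR by simp
    have "norm z * x \<le> s * R" if "norm (z * q) < 1"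
      unfolding x_def mult.assoc[symmetric] using R that
      by (intro mult_right_mono) (auto simp: s_def norm_mult)
    then show "norm z * x < 1 \<or> \<nu> \<in> \<nat>" using sR assms by auto
  qed
  obtain C where C: "C > 0" "\<And>k. norm (pochhammer d k * rGamma (e + of_nat k)) \<le> C * R ^ k"
    using pochhammer_rGamma_bound[OF R, of d e] by blast
  define c where "c = binom_quot_coeff \<nu> z"
  define f where "f = (\<lambda>n k. c n * q ^ n * ((\<nu> gchoose k) * q ^ k)
      * (pochhammer d (n + k) * rGamma (e + of_nat (n + k))))"
  have diag: "f (N - k) k = c (N - k) * (\<nu> gchoose k)
      * (pochhammer d N * rGamma (e + of_nat N) * q ^ N)" if "k \<le> N" for N k
  proof -
    have "q ^ N = q ^ (N - k) * q ^ k" using that by (simp flip: power_add)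
    then show ?thesis using that by (simp add: f_def mult_ac)
  qed
  have sum1: "summable (\<lambda>k. norm (norm (\<nu> gchoose k) * x ^ k))"
    using summable_norm_gbinomial_power[of x \<nu>] x by simp
  have sumc: "summable (\<lambda>n. norm (norm (c n) * x ^ n))"
  proof -
    \<comment> \<open>\<open>c n\<close> is itself a convolution, so its majorant is a Cauchy
      product of binomial series at radii \<open>norm z * x\<close> and \<open>x\<close>. The first
      terminates for natural \<open>\<nu>\<close>.\<close>
    have bound: "norm (c n) * x ^ n \<le> (\<Sum>k\<le>n. (norm (\<nu> gchoose k) * (norm z * x) ^ k)
        * (norm ((- \<nu>) gchoose (n - k)) * x ^ (n - k)))" for n
    proof -
      have "norm (c n) * x ^ n \<le>
          (\<Sum>k\<le>n. norm ((\<nu> gchoose k) * z ^ k * ((- \<nu>) gchoose (n - k)))) * x ^ n"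
        unfolding c_def binom_quot_coeff_def using x by (intro mult_right_mono norm_sum) auto
      also have "\<dots> = (\<Sum>k\<le>n. (norm (\<nu> gchoose k) * (norm z * x) ^ k)
        * (norm ((- \<nu>) gchoose (n - k)) * x ^ (n - k)))"
        unfolding sum_distrib_right
      proof (rule sum.cong[OF refl])
        fix k assume "k \<in> {..n}"
        then have "x ^ n = x ^ k * x ^ (n - k)" by (simp flip: power_add)
        then show "norm ((\<nu> gchoose k) * z ^ k * ((- \<nu>) gchoose (n - k))) * x ^ n =
          (norm (\<nu> gchoose k) * (norm z * x) ^ k) * (norm ((- \<nu>) gchoose (n - k)) * x ^ (n - k))"
          by (simp add: norm_mult norm_power power_mult_distrib mult_ac)
      qed
      finally show ?thesis .
    qed
    have "summable (\<lambda>n. \<Sum>k\<le>n. (norm (\<nu> gchoose k) * (norm z * x) ^ k)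
        * (norm ((- \<nu>) gchoose (n - k)) * x ^ (n - k)))"
      using summable_norm_gbinomial_power[of "norm z * x" \<nu>]
        summable_norm_gbinomial_power[of x "- \<nu>"] x zx
      by (intro summable_Cauchy_product) auto
    then show ?thesis
      by (rule summable_comparison_test'[of _ 0]) (use bound x in simp)
  qed
  have bound: "(\<Sum>k\<le>N. norm (f (N - k) k)) \<le>
      C * (\<Sum>k\<le>N. (norm (\<nu> gchoose k) * x ^ k) * (norm (c (N - k)) * x ^ (N - k)))" for N
    unfolding sum_distrib_left
  proof (rule sum_mono)
    fix k assume "k \<in> {..N}"
    then have k: "k \<le> N" by simp
    have "norm (f (N - k) k) = norm (c (N - k)) * norm (\<nu> gchoose k) * norm q ^ N
        * norm (pochhammer d N * rGamma (e + of_nat N))"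
      by (simp add: diag[OF k] norm_mult norm_power)
    also have "\<dots> \<le> norm (c (N - k)) * norm (\<nu> gchoose k) * norm q ^ N * (C * R ^ N)"
      by (intro mult_left_mono C) auto
    also have "\<dots> = C * (norm (\<nu> gchoose k) * norm (c (N - k)) * x ^ N)"
      by (simp add: x_def power_mult_distrib mult_ac)
    also have "x ^ N = x ^ k * x ^ (N - k)"
      using k by (simp flip: power_add)
    finally show "norm (f (N - k) k) \<le>
        C * ((norm (\<nu> gchoose k) * x ^ k) * (norm (c (N - k)) * x ^ (N - k)))"
      by (simp add: mult_ac)
  qed
  have "summable (\<lambda>N. C * (\<Sum>k\<le>N. (norm (\<nu> gchoose k) * x ^ k)
      * (norm (c (N - k)) * x ^ (N - k))))"
    by (intro summable_mult summable_Cauchy_product sum1 sumc)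
  then have abs: "summable (\<lambda>N. \<Sum>k\<le>N. norm (f (N - k) k))"
    by (rule summable_comparison_test'[of _ 0]) (use bound in \<open>simp add: sum_nonneg\<close>)
  have "(\<lambda>n. \<Sum>k. f n k) sums (\<Sum>N. \<Sum>k\<le>N. f (N - k) k)"
    by (rule sums_suminf_diagonal[OF abs])
  also have "(\<Sum>N. \<Sum>k\<le>N. f (N - k) k) = hyp2F1_reg (- \<nu>) d e (- (z * q))"
  proof -
    have "(\<Sum>k\<le>N. f (N - k) k) = pochhammer (- \<nu>) N * pochhammer d N * rGamma (e + of_nat N)
        / fact N * (- (z * q)) ^ N" for N
    proof -
      have "(\<Sum>k\<le>N. f (N - k) k) = (\<nu> gchoose N) * z ^ N
          * (pochhammer d N * rGamma (e + of_nat N) * q ^ N)"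
        using binom_quot_coeff_convolution[of \<nu> z N]
        by (simp add: diag c_def flip: sum_distrib_right)
      moreover have "(- (z * q)) ^ N = (- 1) ^ N * z ^ N * q ^ N"
        by (subst power_minus) (simp add: power_mult_distrib)
      ultimately show ?thesis
        by (simp add: gbinomial_pochhammer)
    qed
    then show ?thesis by (simp add: hyp2F1_reg_def)
  qed
  also have "(\<lambda>n. \<Sum>k. f n k) = (\<lambda>n. pochhammer d n * c n * q ^ n *
      hyp2F1_reg (- \<nu>) (d + of_nat n) (e + of_nat n) (- q))"
  proof
    fix n
    define K where "K = pochhammer d n * c n * q ^ n"
    define t where "t = (\<lambda>k. pochhammer (- \<nu>) k * pochhammer (d + of_nat n) k
        * rGamma (e + of_nat n + of_nat k) / fact k * (- q) ^ k)"
    have f: "f n = (\<lambda>k. K * t k)"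
      by (simp add: fun_eq_iff f_def K_def t_def gbinomial_pochhammer power_minus[of q]
          pochhammer_product' add.assoc mult_ac)
    \<comment> \<open>For \<open>K = 0\<close> summability of \<open>t\<close> cannot be inferred,
      but both sides are 0.\<close>
    have "(\<Sum>k. K * t k) = K * suminf t"
      using sums_suminf_diagonal(1)[OF abs, of n] unfolding f
      by (cases "K = 0") (auto simp: suminf_mult)
    then show "(\<Sum>k. f n k) = pochhammer d n * c n * q ^ n *
      hyp2F1_reg (- \<nu>) (d + of_nat n) (e + of_nat n) (- q)"
      by (simp add: f K_def hyp2F1_reg_def t_def)
  qed
  finally show ?thesis by (simp add: c_def)
qed

section \<open>Ferrers functions at hyperbolic tangents\<close>

lemma powr_of_real_pos: "x > 0 \<Longrightarrow> of_real x powr a = exp (a * of_real (ln x))" for a :: complex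
  by (simp add: powr_def Ln_of_real)

text \<open>With \<open>q = exp (- 2 * \<alpha>)\<close> the hypergeometric argument is
  \<open>w = q / (1 + q)\<close>, and \<open>w / (1 - w) = q\<close>, so Pfaff's transformation
  produces the argument \<open>- q\<close>. The condition \<open>\<alpha> > 0\<close> amounts to
  \<open>w < 1 / 2\<close>.\<close>

lemma ferrers_P_tanh:
  assumes "\<alpha> > 0 \<or> \<nu> \<in> \<nat>"
  shows "ferrers_P \<nu> (- \<mu>) (tanh \<alpha>) = exp (- (of_real \<alpha> * \<mu>)) *
    of_real (1 + exp (- 2 * \<alpha>)) powr (- \<nu>) *
    hyp2F1_reg (- \<nu>) (\<mu> - \<nu>) (1 + \<mu>) (- of_real (exp (- 2 * \<alpha>)))"
proof -
  define q where "q = exp (- 2 * \<alpha>)"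
  define w where "w = q / (1 + q)"
  have q: "q > 0" by (simp add: q_def)
  have th: "tanh \<alpha> = (1 - q) / (1 + q)"
    by (simp add: tanh_real_altdef q_def)
  have 1: "(1 - tanh \<alpha>) / (1 + tanh \<alpha>) = q" and 2: "(1 - tanh \<alpha>) / 2 = w"
    using q unfolding th w_def by (auto simp: field_simps)
  have w: "0 < w" "w < 1" "1 - w = 1 / (1 + q)" "w / (1 - w) = q"
    using q by (auto simp: w_def field_simps)
  have "norm (complex_of_real w) < 1 / 2 \<or> - (- \<nu>) \<in> \<nat>"
  proof (cases "\<alpha> > 0")
    case True
    then have "q < 1" by (simp add: q_def)
    then have "w < 1 / 2" using q by (simp add: w_def field_simps)
    then show ?thesis using w by simp
  qed (use assms in auto)
  moreover have "norm (complex_of_real w) < 1" using w by simp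
  ultimately have "hyp2F1_reg (- \<nu>) (\<nu> + 1) (1 + \<mu>) (of_real w) =
      (1 - of_real w) powr \<nu> *
      hyp2F1_reg (- \<nu>) (1 + \<mu> - (\<nu> + 1)) (1 + \<mu>) (- (of_real w / (1 - of_real w)))"
    using hyp2F1_reg_Pfaff[of "of_real w" "- \<nu>" "\<nu> + 1" "1 + \<mu>"] by simp
  moreover have "1 - complex_of_real w = of_real (1 / (1 + q))"
    unfolding w(3)[symmetric] by simp
  moreover have "complex_of_real w / of_real (1 / (1 + q)) = of_real q"
    unfolding of_real_divide[symmetric] w(3)[symmetric] w(4) ..
  ultimately have "hyp2F1_reg (- \<nu>) (\<nu> + 1) (1 + \<mu>) (of_real w) =
      of_real (1 / (1 + q)) powr \<nu> * hyp2F1_reg (- \<nu>) (\<mu> - \<nu>) (1 + \<mu>) (- of_real q)"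
    by (simp only:) simp
  moreover have "of_real (1 / (1 + q)) powr \<nu> = of_real (1 + q) powr (- \<nu>)"
    using q by (subst (1 2) powr_of_real_pos) (auto simp: ln_div)
  moreover have "of_real q powr (\<mu> / 2) = exp (- (of_real \<alpha> * \<mu>))"
    by (subst powr_of_real_pos) (auto simp: q_def mult.commute)
  ultimately show ?thesis
    unfolding ferrers_P_def 1 2 by (simp add: q_def)
qed

theorem theorem30:
  fixes \<mu> \<nu> :: complex and \<alpha> \<beta> :: real
  assumes "\<alpha> > 0" and "\<alpha> + \<beta> > 0 \<or> \<nu> \<in> \<nat>"
  shows "(\<lambda>n. (- 1) ^ n * pochhammer (\<mu> - \<nu>) n * poch_cal_F \<mu> \<nu> n \<beta>
              / (fact n * of_real (exp (\<alpha> * real n)))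
              * ferrers_P \<nu> (- \<mu> - of_nat n) (tanh \<alpha>))
         sums (of_real (1 + tanh \<beta> * tanh \<alpha>) powr \<nu> * ferrers_P \<nu> (- \<mu>) (tanh (\<alpha> + \<beta>)))"
proof -
  define q where "q = exp (- 2 * \<alpha>)"
  define z where "z = exp (- 2 * \<beta>)"
  have qz: "q > 0" "z > 0" by (auto simp: q_def z_def)
  have zq: "z * q = exp (- 2 * (\<alpha> + \<beta>))"
    by (simp add: q_def z_def flip: exp_add)
  \<comment> \<open>\<open>K\<close> collects the factors of the summands that are independent of
    \<open>n\<close>.\<close>
  define K where "K = exp (of_real \<beta> * (\<nu> - \<mu>)) / of_real (cosh \<beta>) powr \<nu>
      * exp (- (of_real \<alpha> * \<mu>)) * of_real (1 + q) powr (- \<nu>)"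
  define H where "H = (\<lambda>n. hyp2F1_reg (- \<nu>) (\<mu> - \<nu> + of_nat n) (1 + \<mu> + of_nat n) (- of_real q))"
  have "(\<lambda>n. pochhammer (\<mu> - \<nu>) n * binom_quot_coeff \<nu> (of_real z) n * of_real q ^ n * H n)
      sums hyp2F1_reg (- \<nu>) (\<mu> - \<nu>) (1 + \<mu>) (- (of_real z * of_real q))"
    unfolding H_def
  proof (rule hyp2F1_reg_rescale_sums)
    show "norm (complex_of_real q) < 1"
      using assms(1) qz by (simp add: q_def)
    have "z * q < 1" if "\<alpha> + \<beta> > 0"
      using that by (simp add: zq)
    then show "norm (complex_of_real z * complex_of_real q) < 1 \<or> \<nu> \<in> \<nat>"
      using assms(2) qz by (auto simp: norm_mult)
  qed
  then have "(\<lambda>n. K * (pochhammer (\<mu> - \<nu>) n * binom_quot_coeff \<nu> (of_real z) n * of_real q ^ n * H n))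
      sums (K * hyp2F1_reg (- \<nu>) (\<mu> - \<nu>) (1 + \<mu>) (- (of_real z * of_real q)))"
    by (rule sums_mult)
  also have "(\<lambda>n. K * (pochhammer (\<mu> - \<nu>) n * binom_quot_coeff \<nu> (of_real z) n * of_real q ^ n * H n)) =
    (\<lambda>n. (- 1) ^ n * pochhammer (\<mu> - \<nu>) n * poch_cal_F \<mu> \<nu> n \<beta>
              / (fact n * of_real (exp (\<alpha> * real n)))
              * ferrers_P \<nu> (- \<mu> - of_nat n) (tanh \<alpha>))"
  proof
    fix n
    have "ferrers_P \<nu> (- \<mu> - of_nat n) (tanh \<alpha>) =
        exp (- (of_real \<alpha> * (\<mu> + of_nat n))) * of_real (1 + q) powr (- \<nu>) * H n"
      using ferrers_P_tanh[of \<alpha> \<nu> "\<mu> + of_nat n"] assms(1)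
      by (simp add: H_def q_def algebra_simps)
    \<comment> \<open>One factor \<open>exp (- \<alpha> n)\<close> comes from the Ferrers function
      of shifted order, the other from the series coefficient; together they make
      \<open>q ^ n\<close>.\<close>
    moreover have "exp (- (of_real \<alpha> * (\<mu> + of_nat n))) / of_real (exp (\<alpha> * real n)) =
        exp (- (of_real \<alpha> * \<mu>)) * complex_of_real q ^ n"
      by (simp add: q_def exp_of_real[symmetric] flip: exp_diff exp_add exp_of_nat_mult)
        (simp add: algebra_simps)
    moreover note poch_hyp2F1_conv_binom_quot_coeff[of n \<nu> "of_real z", symmetric]
    ultimately show "K * (pochhammer (\<mu> - \<nu>) n * binom_quot_coeff \<nu> (of_real z) n * of_real q ^ n * H n) =
      (- 1) ^ n * pochhammer (\<mu> - \<nu>) n * poch_cal_F \<mu> \<nu> n \<beta>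
              / (fact n * of_real (exp (\<alpha> * real n)))
              * ferrers_P \<nu> (- \<mu> - of_nat n) (tanh \<alpha>)"
      by (simp add: K_def poch_cal_F_def z_def field_simps)
  qed
  also have "K * hyp2F1_reg (- \<nu>) (\<mu> - \<nu>) (1 + \<mu>) (- (of_real z * of_real q)) =
    of_real (1 + tanh \<beta> * tanh \<alpha>) powr \<nu> * ferrers_P \<nu> (- \<mu>) (tanh (\<alpha> + \<beta>))"
  proof -
    have pos: "1 + z * q > 0" "1 + q > 0" "cosh \<beta> > 0"
      using qz by (auto intro!: add_pos_pos)
    \<comment> \<open>The goal is to write \<open>1 + tanh \<beta> * tanh \<alpha>\<close> as a
      quotient of positive factors; its \<open>\<nu>\<close>-th power then accounts for the powers
      in \<open>K\<close> and the factor \<open>(1 + z * q) powr (- \<nu>)\<close> of the Ferrers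
      function at \<open>\<alpha> + \<beta>\<close>.\<close>
    have "cosh \<beta> = exp \<beta> * ((1 + z) / 2)"
      by (simp add: cosh_field_def z_def field_simps flip: exp_add)
    then have "exp \<beta> * (1 + z * q) / ((1 + q) * cosh \<beta>) = 2 * (1 + z * q) / ((1 + q) * (1 + z))"
      using qz by (simp only:) (simp add: divide_simps)
    also have "\<dots> = 1 + (1 - z) / (1 + z) * ((1 - q) / (1 + q))"
      using qz by (simp add: divide_simps) (simp add: algebra_simps)
    also have "\<dots> = 1 + tanh \<beta> * tanh \<alpha>"
      by (simp add: tanh_real_altdef q_def z_def)
    finally have t: "1 + tanh \<beta> * tanh \<alpha> = exp \<beta> * (1 + z * q) / ((1 + q) * cosh \<beta>)" ..
    \<comment> \<open>All bases are positive, so real logarithms reduce the complex powers to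
      exponentials without branch issues.\<close>
    have "ln (1 + tanh \<beta> * tanh \<alpha>) = \<beta> + ln (1 + z * q) - ln (1 + q) - ln (cosh \<beta>)"
      unfolding t using pos by (simp add: ln_div ln_mult)
    moreover have "1 + tanh \<beta> * tanh \<alpha> > 0"
      unfolding t using pos by simp
    ultimately have 1: "of_real (1 + tanh \<beta> * tanh \<alpha>) powr \<nu> =
        exp (\<nu> * of_real (\<beta> + ln (1 + z * q) - ln (1 + q) - ln (cosh \<beta>)))"
      by (simp only: powr_of_real_pos)
    have "K * hyp2F1_reg (- \<nu>) (\<mu> - \<nu>) (1 + \<mu>) (- (of_real z * of_real q)) =
      of_real (1 + tanh \<beta> * tanh \<alpha>) powr \<nu> * (exp (- (of_real (\<alpha> + \<beta>) * \<mu>)) *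
      of_real (1 + z * q) powr (- \<nu>) *
      hyp2F1_reg (- \<nu>) (\<mu> - \<nu>) (1 + \<mu>) (- of_real (z * q)))"
      unfolding K_def 1 powr_of_real_pos[OF pos(1)] powr_of_real_pos[OF pos(2)]
        powr_of_real_pos[OF pos(3)]
      by (simp flip: exp_add exp_diff) (simp add: algebra_simps)
    then show ?thesis
      using ferrers_P_tanh[of "\<alpha> + \<beta>" \<nu> \<mu>] assms(2) unfolding zq by simp
  qed
  finally show ?thesis .
qed

end
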